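(* Let $H$ be a Hilbert space, let $F:\mathscr{D}(F)\subseteq U\to H$ and $h$ satisfy (A1)–(A7) of the context, and let $\bar u$, $\xi\in\partial h(\bar u)$, $\rho>0$ and $c>0$ satisfy the nonlinearity assumption (N) of the context, where the $h$-minimizing solution $\bar u$ lies in the interior of $\mathscr{D}(F)$. Assume also that there exists $\omega\in U$ such that $\xi=F'(\bar u)^*F'(\bar u)\omega\in\partial h(\bar u)$ and $c\,\|F'(\bar u)\omega\|<1$. For $\alpha>0$ let $u_\alpha$ be a minimizer of the Tikhonov functional with exact data, $J_\alpha(u)=\frac12\|F(u)-y\|^2+\alpha h(u)$, and put $s=D_h^{\xi}(\bar u-\alpha\omega,\bar u)$. Then, for $\alpha>0$ sufficiently small, $$\|F(u_\alpha)-F(\bar u)\|\le\alpha\|F'(\bar u)\omega\|+\sqrt{(cs)^2+2\alpha s\left(1+c\|F'(\bar u)\omega\|\right)},$$ $$D_h^{\xi}(u_\alpha,\bar u)\le\frac{\alpha s+(cs)^2/2+\alpha cs\|F'(\bar u)\omega\|}{\alpha\left(1-c\|F'(\bar u)\omega\|\right)}.$$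
   Context: $U$ is a Banach space and $H$ a Hilbert space (infinite-dimensional), with duals $U^*,H^*$, and $H^*$ identified with $H$; $\langle\cdot,\cdot\rangle$ is the duality pairing of $U^*\times U$; $y\in H$ is the exact datum of the equation $F(u)=y$. Standing assumptions. (A1) $U$ and $H$ carry topologies $\tau_U$ and $\tau_H$, respectively, weaker than the norm topologies. (A2) The topological duals of $U$, $H$ are denoted $U^*$, $H^*$. (A3) The norm of $H$ is sequentially lower semicontinuous with respect to $\tau_H$. (A4) $\mathscr{D}(F)$ has non-empty interior in the norm topology and is $\tau_U$-closed; $\mathscr{D}(F)\cap\operatorname{dom}h\ne\emptyset$. (A5) $F:\mathscr{D}(F)\subseteq U\to H$ is continuous from $(U,\tau_U)$ to $(H,\tau_H)$. (A6) $h:U\to[0,+\infty]$ is proper, convex, bounded from below and $\tau_U$-lower semicontinuous; $\operatorname{dom}h=\{u: h(u)<\infty\}$. (A7) For all $M>0$, $\alpha>0$ the set $\{u : J_\alpha(u)\le M\}$ is $\tau_U$-compact in the sense that every sequence in it has a $\tau_U$-convergent subsequence. Here $J_\alpha$ is considered on $\mathscr{D}(F)$. $h$-minimizing solution: $\bar u\in\operatorname{dom}h\cap\mathscr{D}(F)$ with $F(\bar u)=y$ that minimizes $h$ among all $u$ with $F(u)=y$. Bregman distance: for $u,v\in\operatorname{dom}h$ and $\xi\in\partial h(u)\subseteq U^*$ (subdifferential), $D_h^\xi(v,u)=h(v)-h(u)-\langle\xi,v-u\rangle$. Assumption (N): an $h$-minimizing solution $\bar u$ of $F(u)=y$ exists,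 $F$ is Gâteaux differentiable, and there are $\rho>0$, $c>0$ and $\xi\in\partial h(\bar u)$ such that for every $u\in\mathscr{D}(F)\cap B_\rho(\bar u)$ ($B_\rho(\bar u)$ the ball of radius $\rho$ around $\bar u$) $$\|F(u)-F(\bar u)-F'(\bar u)(u-\bar u)\|\le c\,D_h^\xi(u,\bar u).$$ $F'(\bar u):U\to H$ is the (linear) derivative and $F'(\bar u)^*:H\to U^*$ its adjoint, $\langle F'(\bar u)^*v,u\rangle=\langle v,F'(\bar u)u\rangle_H$.
   Formalization: The formal theorem additionally assumes that u_α lies in the ball B_ρ(ū) for all sufficiently small α (the claim fails without this), and asserts the bounds only for those α with ū−αω in dom h, where s is defined. *)

theory Defs
  imports "HOL-Analysis.Analysis"
begin

definition weaker_than_norm_topology :: "'a::real_normed_vector topology \<Rightarrow> bool" where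
  "weaker_than_norm_topology \<tau> \<longleftrightarrow>
     topspace \<tau> = UNIV \<and> (\<forall>S. openin \<tau> S \<longrightarrow> open S)"

definition norm_seq_lsc :: "'a::real_normed_vector topology \<Rightarrow> bool" where
  "norm_seq_lsc \<tau> \<longleftrightarrow>
     (\<forall>x l. limitin \<tau> x l sequentially \<longrightarrow>
        ereal (norm l) \<le> liminf (\<lambda>n. ereal (norm (x n))))"

text \<open>A penalty is a function with values in \<open>ereal\<close>; its effective domain is the set where
  it is below \<open>\<infinity>\<close>.\<close>

definition effective_dom :: "('a \<Rightarrow> ereal) \<Rightarrow> 'a set" where
  "effective_dom h = {u. h u < \<infinity>}"

definition proper_fun :: "('a \<Rightarrow> ereal) \<Rightarrow> bool" where
  "proper_fun h \<longleftrightarrow> (\<forall>u. h u \<noteq> - \<infinity>) \<and> effective_dom h \<noteq> {}"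

definition convex_ereal_fun :: "('a::real_vector \<Rightarrow> ereal) \<Rightarrow> bool" where
  "convex_ereal_fun h \<longleftrightarrow>
     (\<forall>u v. \<forall>t\<in>{0..1}.
        h ((1 - t) *\<^sub>R u + t *\<^sub>R v) \<le> ereal (1 - t) * h u + ereal t * h v)"

definition lower_semicontinuous_in :: "'a topology \<Rightarrow> ('a \<Rightarrow> ereal) \<Rightarrow> bool" where
  "lower_semicontinuous_in \<tau> h \<longleftrightarrow> (\<forall>a. openin \<tau> {u \<in> topspace \<tau>. a < h u})"

text \<open>The dual \<open>U\<^sup>*\<close> is the type \<open>'a \<Rightarrow>\<^sub>L real\<close> of bounded linear functionals, with the duality
  pairing given by application.\<close>

definition subdifferential ::
    "('a::real_normed_vector \<Rightarrow> ereal) \<Rightarrow> 'a \<Rightarrow> ('a \<Rightarrow>\<^sub>L real) set" where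
  "subdifferential h u =
     {\<xi>. u \<in> effective_dom h \<and> (\<forall>v. h u + ereal (blinfun_apply \<xi> (v - u)) \<le> h v)}"

text \<open>\<open>bregman h \<xi> v u\<close> is the Bregman distance \<open>D\<^sub>h\<^sup>\<xi>(v, u)\<close>. It is meaningful only for
  \<open>u\<close>, \<open>v\<close> in \<open>effective_dom h\<close> (elsewhere \<open>real_of_ereal \<infinity> = 0\<close>), so every use has to be
  restricted to such points.\<close>

definition bregman ::
    "('a::real_normed_vector \<Rightarrow> ereal) \<Rightarrow> ('a \<Rightarrow>\<^sub>L real) \<Rightarrow> 'a \<Rightarrow> 'a \<Rightarrow> real" where
  "bregman h \<xi> v u =
     real_of_ereal (h v) - real_of_ereal (h u) - blinfun_apply \<xi> (v - u)"

text \<open>Functions \<open>F : D \<rightarrow> H\<close> are total functions of which only the values on \<open>D\<close> matter. For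
  \<open>u\<close> in the interior of \<open>D\<close> the Gateaux derivative depends only on those values.\<close>

definition has_gateaux_derivative ::
    "('a::real_normed_vector \<Rightarrow> 'b::real_normed_vector) \<Rightarrow> ('a \<Rightarrow>\<^sub>L 'b) \<Rightarrow> 'a \<Rightarrow> bool" where
  "has_gateaux_derivative F A u \<longleftrightarrow>
     (\<forall>v. ((\<lambda>t::real. (F (u + t *\<^sub>R v) - F u) /\<^sub>R t) \<longlongrightarrow> blinfun_apply A v) (at 0))"

text \<open>The adjoint \<open>A\<^sup>* : H \<rightarrow> U\<^sup>*\<close>, where \<open>H\<^sup>*\<close> is identified with \<open>H\<close>.\<close>

definition dual_adjoint ::
    "('a::real_normed_vector \<Rightarrow>\<^sub>L 'b::real_inner) \<Rightarrow> 'b \<Rightarrow> ('a \<Rightarrow>\<^sub>L real)" where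
  "dual_adjoint A v = blinfun_inner_right v o\<^sub>L A"

lemma dual_adjoint_apply: "blinfun_apply (dual_adjoint A v) u = v \<bullet> blinfun_apply A u"
  by (simp add: dual_adjoint_def)

definition h_minimizing_solution ::
    "'a set \<Rightarrow> ('a \<Rightarrow> 'b) \<Rightarrow> ('a \<Rightarrow> ereal) \<Rightarrow> 'b \<Rightarrow> 'a \<Rightarrow> bool" where
  "h_minimizing_solution D F h y u \<longleftrightarrow>
     u \<in> effective_dom h \<inter> D \<and> F u = y \<and> (\<forall>v\<in>D. F v = y \<longrightarrow> h u \<le> h v)"

definition tikhonov ::
    "('a \<Rightarrow> 'b::real_normed_vector) \<Rightarrow> ('a \<Rightarrow> ereal) \<Rightarrow> 'b \<Rightarrow> real \<Rightarrow> 'a \<Rightarrow> ereal" where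
  "tikhonov F h y \<alpha> u = ereal (1 / 2 * (norm (F u - y))\<^sup>2) + ereal \<alpha> * h u"

definition tikhonov_minimizer ::
    "'a set \<Rightarrow> ('a \<Rightarrow> 'b::real_normed_vector) \<Rightarrow> ('a \<Rightarrow> ereal) \<Rightarrow> 'b \<Rightarrow> real \<Rightarrow> 'a \<Rightarrow> bool" where
  "tikhonov_minimizer D F h y \<alpha> u \<longleftrightarrow>
     u \<in> D \<and> (\<forall>v\<in>D. tikhonov F h y \<alpha> u \<le> tikhonov F h y \<alpha> v)"

text \<open>Only the existence of a convergent subsequence is required; the limit is not asked to lie
  in \<open>S\<close>.\<close>

definition subseq_compact_in :: "'a topology \<Rightarrow> 'a set \<Rightarrow> bool" where
  "subseq_compact_in \<tau> S \<longleftrightarrow>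
     (\<forall>x::nat \<Rightarrow> 'a. (\<forall>n. x n \<in> S) \<longrightarrow>
        (\<exists>l r. strict_mono r \<and> limitin \<tau> (x \<circ> r) l sequentially))"

end

theory Submission
  imports Defs
begin

text \<open>Write \<open>A = F'(ubar)\<close>, \<open>a = A \<omega>\<close>, \<open>g = \<parallel>a\<parallel>\<close>, \<open>E = F(u\<^sub>\<alpha>) - F(ubar)\<close> and
  \<open>d = D\<^sub>h\<^sup>\<xi>(u\<^sub>\<alpha>, ubar)\<close>, and compare the Tikhonov values at \<open>u\<^sub>\<alpha>\<close> and at the competitor
  \<open>ubar - \<alpha> \<omega>\<close>. By the source condition \<open>\<xi>\<close> is \<open>x \<mapsto> a \<bullet> A x\<close>, so the linear parts of the two
  Bregman distances can be expressed through \<open>E\<close> and the linearization errors, which (N) controls.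
  Completing the square gives
  \<open>\<parallel>E + \<alpha> a\<parallel>\<^sup>2 / 2 + \<alpha> (1 - c g) d \<le> \<alpha> s + (c s)\<^sup>2 / 2 + \<alpha> c s g\<close>,
  and each estimate follows by dropping one of the two nonnegative terms on the left.\<close>

lemma effective_dom_real:
  assumes "\<And>v. 0 \<le> h v" "v \<in> effective_dom h"
  shows "h v = ereal (real_of_ereal (h v))"
  using assms(1)[of v] assms(2) by (cases "h v") (auto simp: effective_dom_def)

lemma bregman_nonneg:
  assumes nonneg: "\<And>v. 0 \<le> h v"
    and sub: "\<xi> \<in> subdifferential h u" and v: "v \<in> effective_dom h"
  shows "0 \<le> bregman h \<xi> v u"
proof -
  have "u \<in> effective_dom h" and le: "h u + ereal (blinfun_apply \<xi> (v - u)) \<le> h v"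
    using sub by (auto simp: subdifferential_def)
  then obtain p q where "h u = ereal p" "h v = ereal q"
    using effective_dom_real[of h, OF nonneg] v by metis
  then show ?thesis
    using le by (simp add: bregman_def)
qed

text \<open>The value at \<open>v\<close> is finite and \<open>\<alpha> > 0\<close>, so
  \<open>h u = \<infinity>\<close> would make the left side infinite. With both penalties finite,
  the comparison passes from extended reals to reals, where linear arithmetic applies.\<close>

lemma tikhonov_le_imp:
  assumes nonneg: "\<And>v. 0 \<le> h v" and "\<alpha> > 0" and v: "v \<in> effective_dom h"
    and le: "tikhonov F h y \<alpha> u \<le> tikhonov F h y \<alpha> v"
  shows "u \<in> effective_dom h"
    and "(norm (F u - y))\<^sup>2 / 2 + \<alpha> * real_of_ereal (h u)
           \<le> (norm (F v - y))\<^sup>2 / 2 + \<alpha> * real_of_ereal (h v)"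
proof -
  obtain q where q: "h v = ereal q"
    using effective_dom_real[of h, OF nonneg v] by metis
  show dom: "u \<in> effective_dom h"
    using le q \<open>\<alpha> > 0\<close> by (cases "h u") (auto simp: tikhonov_def effective_dom_def)
  obtain p where "h u = ereal p"
    using effective_dom_real[of h, OF nonneg dom] by metis
  then show "(norm (F u - y))\<^sup>2 / 2 + \<alpha> * real_of_ereal (h u)
               \<le> (norm (F v - y))\<^sup>2 / 2 + \<alpha> * real_of_ereal (h v)"
    using le q by (simp add: tikhonov_def)
qed

text \<open>Here \<open>\<alpha>\<close> is fixed, and (N) enters only through its instances at the
  competitor and at \<open>u\<close>; placing both points in \<open>D\<close> and in the ball is
  left to the theorem.\<close>

lemma tikhonov_bregman_estimate:
  fixes F :: "'a::real_normed_vector \<Rightarrow> 'b::real_inner" and A :: "'a \<Rightarrow>\<^sub>L 'b"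
    and h :: "'a \<Rightarrow> ereal" and \<xi> :: "'a \<Rightarrow>\<^sub>L real" and u ubar \<omega> :: 'a and \<alpha> c :: real
  defines "a \<equiv> blinfun_apply A \<omega>"
  defines "s \<equiv> bregman h \<xi> (ubar - \<alpha> *\<^sub>R \<omega>) ubar"
  assumes nonneg: "\<And>v. 0 \<le> h v" and \<alpha>: "\<alpha> > 0"
    and dom: "ubar - \<alpha> *\<^sub>R \<omega> \<in> effective_dom h"
    and le: "tikhonov F h (F ubar) \<alpha> u \<le> tikhonov F h (F ubar) \<alpha> (ubar - \<alpha> *\<^sub>R \<omega>)"
    and source: "\<xi> = dual_adjoint A a"
    and nl_v: "norm (F (ubar - \<alpha> *\<^sub>R \<omega>) - F ubar + \<alpha> *\<^sub>R a) \<le> c * s"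
    and nl_u: "norm (F u - F ubar - blinfun_apply A (u - ubar)) \<le> c * bregman h \<xi> u ubar"
  shows "(norm (F u - F ubar + \<alpha> *\<^sub>R a))\<^sup>2 / 2 + \<alpha> * (1 - c * norm a) * bregman h \<xi> u ubar
           \<le> \<alpha> * s + (c * s)\<^sup>2 / 2 + \<alpha> * c * s * norm a"
proof -
  define v where "v = ubar - \<alpha> *\<^sub>R \<omega>"
  define E where "E = F u - F ubar"
  define d where "d = bregman h \<xi> u ubar"
  define r where "r = E - blinfun_apply A (u - ubar)"
  have J: "(norm E)\<^sup>2 / 2 + \<alpha> * real_of_ereal (h u)
             \<le> (norm (F v - F ubar))\<^sup>2 / 2 + \<alpha> * real_of_ereal (h v)"
    using tikhonov_le_imp(2)[of h, OF nonneg \<alpha> dom le] by (simp add: E_def v_def)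
  \<comment> \<open>\<open>r\<close> is the linearization error at \<open>u\<close>, so
    \<open>A (u - ubar) = E - r\<close>.\<close>
  have \<xi>u: "blinfun_apply \<xi> (u - ubar) = a \<bullet> E - a \<bullet> r"
    by (simp add: source dual_adjoint_apply r_def inner_diff_right)
  have \<xi>v: "blinfun_apply \<xi> (v - ubar) = - (\<alpha> * (norm a)\<^sup>2)"
    by (simp add: source dual_adjoint_apply v_def a_def blinfun.minus_right blinfun.scaleR_right
        power2_norm_eq_inner)
  \<comment> \<open>\<open>h ubar\<close> cancels in the difference of the two Bregman
    distances.\<close>
  have h_diff: "real_of_ereal (h v) - real_of_ereal (h u)
                  = s - d - a \<bullet> E + a \<bullet> r - \<alpha> * (norm a)\<^sup>2"
    using \<xi>u \<xi>v by (simp add: s_def d_def bregman_def v_def)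
  have "norm (F v - F ubar) \<le> norm (F v - F ubar + \<alpha> *\<^sub>R a) + norm (\<alpha> *\<^sub>R a)"
    using norm_triangle_ineq4[of "F v - F ubar + \<alpha> *\<^sub>R a" "\<alpha> *\<^sub>R a"] by simp
  \<comment> \<open>\<open>nl_v\<close> bounds the linearization error at \<open>v\<close>, because
    \<open>A (v - ubar) = - \<alpha> a\<close>.\<close>
  then have "norm (F v - F ubar) \<le> c * s + \<alpha> * norm a"
    using nl_v \<alpha> by (simp add: v_def)
  then have "(norm (F v - F ubar))\<^sup>2 \<le> (c * s + \<alpha> * norm a)\<^sup>2"
    by (intro power_mono) auto
  then have Fv: "(norm (F v - F ubar))\<^sup>2 / 2
      \<le> (c * s)\<^sup>2 / 2 + \<alpha> * c * s * norm a + \<alpha>\<^sup>2 * (norm a)\<^sup>2 / 2"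
    by (simp add: power2_sum power_mult_distrib algebra_simps)
  \<comment> \<open>This turns the \<open>r\<close> term into a multiple of \<open>d\<close>; moved
    to the left, it produces the factor \<open>1 - c * norm a\<close>.\<close>
  have "a \<bullet> r \<le> norm a * norm r"
    by (rule norm_cauchy_schwarz)
  also have "\<dots> \<le> norm a * (c * d)"
    using nl_u by (intro mult_left_mono) (auto simp: r_def E_def d_def)
  finally have ar: "\<alpha> * (a \<bullet> r) \<le> \<alpha> * (norm a * (c * d))"
    using \<alpha> by simp
  have sq: "(norm (E + \<alpha> *\<^sub>R a))\<^sup>2 = (norm E)\<^sup>2 + 2 * \<alpha> * (a \<bullet> E) + \<alpha>\<^sup>2 * (norm a)\<^sup>2"
    unfolding power2_norm_eq_inner
    by (simp add: inner_add_left inner_add_right inner_commute power2_eq_square algebra_simps)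
  have coef: "\<alpha> * (1 - c * norm a) * d = \<alpha> * d - \<alpha> * (norm a * (c * d))"
    by (simp add: algebra_simps)
  \<comment> \<open>Half of the last term is offset by the last term of \<open>Fv\<close>; the other
    half, together with \<open>\<alpha> * (a \<bullet> E)\<close>, completes the square in
    \<open>sq\<close>.\<close>
  have "\<alpha> * real_of_ereal (h v) - \<alpha> * real_of_ereal (h u)
          = \<alpha> * s - \<alpha> * d - \<alpha> * (a \<bullet> E) + \<alpha> * (a \<bullet> r) - \<alpha>\<^sup>2 * (norm a)\<^sup>2"
    unfolding right_diff_distrib[symmetric] h_diff
    by (simp add: power2_eq_square algebra_simps)
  then have "(norm (E + \<alpha> *\<^sub>R a))\<^sup>2 / 2 + \<alpha> * (1 - c * norm a) * d
          \<le> \<alpha> * s + (c * s)\<^sup>2 / 2 + \<alpha> * c * s * norm a"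
    using J Fv ar sq coef by linarith
  then show ?thesis
    by (simp add: E_def d_def)
qed

theorem theorem3p5:
  fixes \<tau>U :: "'a::banach topology"
    and \<tau>H :: "'b::{real_inner, complete_space} topology"
    and D :: "'a set"
    and F :: "'a \<Rightarrow> 'b"
    and F' :: "'a \<Rightarrow> ('a \<Rightarrow>\<^sub>L 'b)"
    and h :: "'a \<Rightarrow> ereal"
    and y :: 'b
    and ubar \<omega> :: 'a
    and \<xi> :: "'a \<Rightarrow>\<^sub>L real"
    and \<rho> c :: real
    and u :: "real \<Rightarrow> 'a"
  assumes A1: "weaker_than_norm_topology \<tau>U" "weaker_than_norm_topology \<tau>H"
    and A3: "norm_seq_lsc \<tau>H"
    and A4: "interior D \<noteq> {}" "closedin \<tau>U D" "D \<inter> effective_dom h \<noteq> {}"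
    and A5: "continuous_map (subtopology \<tau>U D) \<tau>H F"
    and A6: "\<And>v. 0 \<le> h v" "proper_fun h" "convex_ereal_fun h" "lower_semicontinuous_in \<tau>U h"
    and A7: "\<And>M \<alpha>. M > 0 \<Longrightarrow> \<alpha> > 0 \<Longrightarrow>
               subseq_compact_in \<tau>U {v \<in> D. tikhonov F h y \<alpha> v \<le> ereal M}"
    and ubar: "h_minimizing_solution D F h y ubar" "ubar \<in> interior D"
    and gateaux: "\<And>v. v \<in> interior D \<Longrightarrow> has_gateaux_derivative F (F' v) v"
    and pos: "\<rho> > 0" "c > 0"
    and subgradient: "\<xi> \<in> subdifferential h ubar"
    and nonlinearity: "\<And>v. v \<in> D \<inter> ball ubar \<rho> \<Longrightarrow> v \<in> effective_dom h \<Longrightarrow>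
               norm (F v - F ubar - blinfun_apply (F' ubar) (v - ubar)) \<le> c * bregman h \<xi> v ubar"
    and source: "\<xi> = dual_adjoint (F' ubar) (blinfun_apply (F' ubar) \<omega>)"
    and small: "c * norm (blinfun_apply (F' ubar) \<omega>) < 1"
    and minimizers: "\<And>\<alpha>. \<alpha> > 0 \<Longrightarrow> tikhonov_minimizer D F h y \<alpha> (u \<alpha>)"
    and local: "\<forall>\<^sub>F \<alpha> in at_right 0. u \<alpha> \<in> ball ubar \<rho>"
  shows "\<forall>\<^sub>F \<alpha> in at_right 0.
    ubar - \<alpha> *\<^sub>R \<omega> \<in> effective_dom h \<longrightarrow>
    (let s = bregman h \<xi> (ubar - \<alpha> *\<^sub>R \<omega>) ubar;
         g = norm (blinfun_apply (F' ubar) \<omega>)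
     in norm (F (u \<alpha>) - F ubar) \<le> \<alpha> * g + sqrt ((c * s)\<^sup>2 + 2 * \<alpha> * s * (1 + c * g)) \<and>
        bregman h \<xi> (u \<alpha>) ubar
          \<le> (\<alpha> * s + (c * s)\<^sup>2 / 2 + \<alpha> * c * s * g) / (\<alpha> * (1 - c * g)))"
proof -
  define g where "g = norm (blinfun_apply (F' ubar) \<omega>)"
  have y: "F ubar = y"
    using ubar(1) by (simp add: h_minimizing_solution_def)
  \<comment> \<open>The competitor tends to \<open>ubar\<close>, an interior point of
    \<open>D\<close>, so for small \<open>\<alpha>\<close> it is admissible for the minimization and
    within reach of (N).\<close>
  have "((\<lambda>\<alpha>. ubar - \<alpha> *\<^sub>R \<omega>) \<longlongrightarrow> ubar - 0 *\<^sub>R \<omega>) (at_right 0)"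
    by (intro tendsto_intros)
  then have "\<forall>\<^sub>F \<alpha> in at_right 0. ubar - \<alpha> *\<^sub>R \<omega> \<in> interior D \<inter> ball ubar \<rho>"
    using ubar(2) pos(1) by (intro topological_tendstoD) auto
  then show ?thesis
    using local eventually_at_right_less[of 0]
  proof eventually_elim
    case (elim \<alpha>)
    then have \<alpha>: "\<alpha> > 0" by simp
    define s where "s = bregman h \<xi> (ubar - \<alpha> *\<^sub>R \<omega>) ubar"
    define d where "d = bregman h \<xi> (u \<alpha>) ubar"
    define R where "R = \<alpha> * s + (c * s)\<^sup>2 / 2 + \<alpha> * c * s * g"
    let ?a = "blinfun_apply (F' ubar) \<omega>"
    have "norm (F (u \<alpha>) - F ubar) \<le> \<alpha> * g + sqrt ((c * s)\<^sup>2 + 2 * \<alpha> * s * (1 + c * g))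
            \<and> d \<le> R / (\<alpha> * (1 - c * g))"
      if dom: "ubar - \<alpha> *\<^sub>R \<omega> \<in> effective_dom h"
    proof -
      have vD: "ubar - \<alpha> *\<^sub>R \<omega> \<in> D \<inter> ball ubar \<rho>"
        using elim(1) interior_subset by blast
      have uD: "u \<alpha> \<in> D \<inter> ball ubar \<rho>"
        and le: "tikhonov F h y \<alpha> (u \<alpha>) \<le> tikhonov F h y \<alpha> (ubar - \<alpha> *\<^sub>R \<omega>)"
        using minimizers[OF \<alpha>] elim(2) vD by (auto simp: tikhonov_minimizer_def)
      \<comment> \<open>Finiteness of \<open>h\<close> at the minimizer is what makes (N) and
        \<open>bregman_nonneg\<close> applicable there.\<close>
      have udom: "u \<alpha> \<in> effective_dom h"
        using tikhonov_le_imp(1)[of h, OF A6(1) \<alpha> dom le] .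
      have main: "(norm (F (u \<alpha>) - F ubar + \<alpha> *\<^sub>R ?a))\<^sup>2 / 2 + \<alpha> * (1 - c * g) * d \<le> R"
        unfolding R_def d_def s_def g_def
      proof (rule tikhonov_bregman_estimate[OF A6(1) \<alpha> dom _ source])
        show "tikhonov F h (F ubar) \<alpha> (u \<alpha>) \<le> tikhonov F h (F ubar) \<alpha> (ubar - \<alpha> *\<^sub>R \<omega>)"
          using le y by simp
        show "norm (F (ubar - \<alpha> *\<^sub>R \<omega>) - F ubar + \<alpha> *\<^sub>R ?a)
                \<le> c * bregman h \<xi> (ubar - \<alpha> *\<^sub>R \<omega>) ubar"
          using nonlinearity[OF vD dom] by (simp add: blinfun.minus_right blinfun.scaleR_right)
        show "norm (F (u \<alpha>) - F ubar - blinfun_apply (F' ubar) (u \<alpha> - ubar))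
                \<le> c * bregman h \<xi> (u \<alpha>) ubar"
          using nonlinearity[OF uD udom] .
      qed
      have coef: "\<alpha> * (1 - c * g) > 0"
        using \<alpha> small by (simp add: g_def)
      have "d \<ge> 0"
        using bregman_nonneg[of h, OF A6(1) subgradient udom] by (simp add: d_def)
      then have "\<alpha> * (1 - c * g) * d \<ge> 0"
        by (rule mult_nonneg_nonneg[OF less_imp_le[OF coef]])
      \<comment> \<open>The Bregman term is dropped; the right side is \<open>2 * R\<close>.\<close>
      then have "(norm (F (u \<alpha>) - F ubar + \<alpha> *\<^sub>R ?a))\<^sup>2 \<le> (c * s)\<^sup>2 + 2 * \<alpha> * s * (1 + c * g)"
        using main by (simp add: R_def algebra_simps)
      then have "norm (F (u \<alpha>) - F ubar + \<alpha> *\<^sub>R ?a) \<le> sqrt ((c * s)\<^sup>2 + 2 * \<alpha> * s * (1 + c * g))"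
        by (rule real_le_rsqrt)
      \<comment> \<open>Undoing the shift by \<open>\<alpha> *\<^sub>R ?a\<close> costs the summand
        \<open>\<alpha> * g\<close> of the first bound.\<close>
      moreover have "norm (F (u \<alpha>) - F ubar)
          \<le> norm (F (u \<alpha>) - F ubar + \<alpha> *\<^sub>R ?a) + norm (\<alpha> *\<^sub>R ?a)"
        using norm_triangle_ineq4[of "F (u \<alpha>) - F ubar + \<alpha> *\<^sub>R ?a" "\<alpha> *\<^sub>R ?a"] by simp
      moreover have "norm (\<alpha> *\<^sub>R ?a) = \<alpha> * g"
        using \<alpha> by (simp add: g_def)
      \<comment> \<open>For the second bound the square is dropped instead; \<open>coef\<close> then
        permits the division.\<close>
      moreover have "\<alpha> * (1 - c * g) * d \<le> R"
        using main zero_le_power2[of "norm (F (u \<alpha>) - F ubar + \<alpha> *\<^sub>R ?a)"] by linarith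
      then have "d \<le> R / (\<alpha> * (1 - c * g))"
        using coef by (simp add: pos_le_divide_eq mult.commute)
      ultimately show ?thesis by linarith
    qed
    then show ?case
      by (simp add: Let_def s_def d_def R_def g_def)
  qed
qed

end
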